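(* Let $\mathbf{d}\in\mathbb{R}^D$ with $\|\mathbf{d}\|=1$ and $\gamma$ be fixed, and let $\mathcal{S}$ be the set of subbands $\mathcal{S}=\{R^{(2)}(\alpha,\beta,\mathbf{d},\gamma)\mid 0\le\alpha\le\beta\}$, where $$R^{(2)}(\alpha,\beta,\mathbf{d},\gamma)=\{\omega\in\mathbb{R}^D : \alpha\le\|\omega\|_2\le\beta,\ \omega^T\mathbf{d}\ge\cos(\gamma)\|\omega\|_2\},$$ written $R^{(2)}(\alpha,\beta)$ for short. If $|\gamma|<\frac{\pi}{4}$, then $\mathcal{S}$ is PNF-controllable. Specifically, if $\omega_1\in R^{(2)}(\alpha_1,\beta_1)\in\mathcal{S}$ and $\omega_2\in R^{(2)}(\alpha_2,\beta_2)\in\mathcal{S}$, then $b_{\omega_1}b_{\omega_2}=b_{\omega_3}$ implies that $$\omega_3\in R^{(2)}\big(\sqrt{\cos(2\gamma)}\,(\alpha_1+\alpha_2),\ \beta_1+\beta_2\big)\in\mathcal{S}.$$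
   Context: For $\omega\in\mathbb{R}^D$, $b_\omega(x)=\exp(i\omega^Tx)$, $x\in\mathbb{R}^D$, is a Fourier basis function; the basis is $\mathcal{B}=\{b_\omega\}_{\omega\in\mathbb{R}^D}$. A subband is a subset of $\mathcal{B}$, identified here with the corresponding set of frequencies $\omega$. A set $\mathcal{S}=\{S_\theta\mid S_\theta\subset\mathcal{B}\}_\theta$ of subbands is PNF-controllable (for polynomial neural fields, PNFs) if (1) $S_{\theta_1}\cup S_{\theta_2}\in\mathcal{S}$ for all $S_{\theta_1},S_{\theta_2}\in\mathcal{S}$, and (2) there exists a binary function $\otimes:\mathcal{S}\times\mathcal{S}\to\mathcal{S}$ such that $b_1\in S_{\theta_1}$, $b_2\in S_{\theta_2}$ implies $b_1b_2\in S_{\theta_1}\otimes S_{\theta_2}$.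
   Formalization: S is never closed under unions (R(0,1) ∪ R(2,3) is not in S), so PNF-controllability is proved for the family of finite unions of members of S; for S itself condition (2) is proved, and in place of (1) only that S1 ∪ S2 lies inside some member of S. *)

theory Defs
  imports "HOL-Analysis.Analysis"
begin

definition fourier :: "real ^ 'n \<Rightarrow> real ^ 'n \<Rightarrow> complex" where
  "fourier \<omega> = (\<lambda>x. exp (\<i> * complex_of_real (\<omega> \<bullet> x)))"

definition fourier_basis :: "(real ^ 'n \<Rightarrow> complex) set" where
  "fourier_basis = range fourier"

definition union_closed :: "'a set set \<Rightarrow> bool" where
  "union_closed \<S> \<longleftrightarrow> (\<forall>S1\<in>\<S>. \<forall>S2\<in>\<S>. S1 \<union> S2 \<in> \<S>)"

definition product_controlled :: "('a \<Rightarrow> complex) set set \<Rightarrow> bool" where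
  "product_controlled \<S> \<longleftrightarrow>
     (\<exists>tensor. \<forall>S1\<in>\<S>. \<forall>S2\<in>\<S>. tensor S1 S2 \<in> \<S> \<and>
        (\<forall>b1\<in>S1. \<forall>b2\<in>S2. (\<lambda>x. b1 x * b2 x) \<in> tensor S1 S2))"

definition pnf_controllable :: "(real ^ 'n \<Rightarrow> complex) set set \<Rightarrow> bool" where
  "pnf_controllable \<S> \<longleftrightarrow>
     (\<forall>S\<in>\<S>. S \<subseteq> fourier_basis) \<and> union_closed \<S> \<and> product_controlled \<S>"

definition R2 :: "real \<Rightarrow> real \<Rightarrow> real ^ 'n \<Rightarrow> real \<Rightarrow> (real ^ 'n) set" where
  "R2 \<alpha> \<beta> d \<gamma> = {\<omega>. \<alpha> \<le> norm \<omega> \<and> norm \<omega> \<le> \<beta> \<and> \<omega> \<bullet> d \<ge> cos \<gamma> * norm \<omega>}"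

text \<open>Frequency sets are turned into sets of basis functions by taking the image under
  \<^const>\<open>fourier\<close>, which is injective (see below).\<close>

definition R2_subbands :: "real ^ 'n \<Rightarrow> real \<Rightarrow> (real ^ 'n \<Rightarrow> complex) set set" where
  "R2_subbands d \<gamma> = {fourier ` R2 \<alpha> \<beta> d \<gamma> | \<alpha> \<beta>. 0 \<le> \<alpha> \<and> \<alpha> \<le> \<beta>}"

text \<open>The least family that contains \<open>\<S>\<close> and is closed under binary unions. It is \<open>\<S>\<close> itself
  if \<open>\<S>\<close> is already closed under binary unions. The family \<^const>\<open>R2_subbands\<close> is not, since
  the union of two disjoint annular sectors need not be an annular sector; it is therefore never
  controllable itself (see \<open>not_pnf_controllable_R2_subbands\<close> below).\<close>

definition finite_unions :: "'a set set \<Rightarrow> 'a set set" where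
  "finite_unions \<S> = {\<Union>\<F> | \<F>. \<F> \<subseteq> \<S> \<and> finite \<F> \<and> \<F> \<noteq> {}}"

lemma inj_fourier: "inj (fourier :: real ^ 'n \<Rightarrow> _)"
proof (rule injI, rule ccontr)
  fix a b :: "real ^ 'n"
  assume eq: "fourier a = fourier b" and "a \<noteq> b"
  define v where "v = a - b"
  have v: "v \<bullet> v \<noteq> 0" using \<open>a \<noteq> b\<close> by (simp add: v_def)
  define x where "x = (pi / (v \<bullet> v)) *\<^sub>R v"
  have "v \<bullet> x = pi" using v by (simp add: x_def)
  then have vx: "a \<bullet> x - b \<bullet> x = pi" by (simp add: v_def inner_diff_left)
  have "exp (\<i> * complex_of_real (a \<bullet> x)) = exp (\<i> * complex_of_real (b \<bullet> x))"
    using fun_cong[OF eq, of x] by (simp add: fourier_def)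
  then have "exp (\<i> * complex_of_real (a \<bullet> x) - \<i> * complex_of_real (b \<bullet> x)) = 1"
    by (simp add: exp_diff)
  moreover have "\<i> * complex_of_real (a \<bullet> x) - \<i> * complex_of_real (b \<bullet> x)
      = \<i> * complex_of_real pi"
    by (simp flip: vx add: algebra_simps)
  ultimately show False by simp
qed

lemma finite_unions_union_closed:
  assumes "union_closed \<S>"
  shows "finite_unions \<S> = \<S>"
proof
  have "\<Union>\<F> \<in> \<S>" if "finite \<F>" "\<F> \<noteq> {}" "\<F> \<subseteq> \<S>" for \<F>
    using that by (induction rule: finite_ne_induct) (use assms in \<open>auto simp: union_closed_def\<close>)
  then show "finite_unions \<S> \<subseteq> \<S>" by (auto simp: finite_unions_def)
  show "\<S> \<subseteq> finite_unions \<S>"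
  proof
    fix S assume "S \<in> \<S>"
    then show "S \<in> finite_unions \<S>"
      unfolding finite_unions_def by (intro CollectI exI[of _ "{S}"]) auto
  qed
qed

lemma not_union_closed_R2_subbands:
  fixes d :: "real ^ 'n"
  assumes d: "norm d = 1"
  shows "\<not> union_closed (R2_subbands d \<gamma>)"
proof
  assume uc: "union_closed (R2_subbands d \<gamma>)"
  have dd: "d \<bullet> d = 1" using d by (simp add: norm_eq_1)
  have ray: "t *\<^sub>R d \<in> R2 \<alpha> \<beta> d \<gamma> \<longleftrightarrow> \<alpha> \<le> t \<and> t \<le> \<beta>" if "0 \<le> t" for t \<alpha> \<beta>
    using that d dd mult_right_mono[of "cos \<gamma>" 1 t] by (auto simp: R2_def mult.commute)
  have "fourier ` R2 0 1 d \<gamma> \<in> R2_subbands d \<gamma>"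
    unfolding R2_subbands_def by (rule CollectI, rule exI[of _ 0], rule exI[of _ 1]) simp
  moreover have "fourier ` R2 2 3 d \<gamma> \<in> R2_subbands d \<gamma>"
    unfolding R2_subbands_def by (rule CollectI, rule exI[of _ 2], rule exI[of _ 3]) simp
  ultimately have "fourier ` R2 0 1 d \<gamma> \<union> fourier ` R2 2 3 d \<gamma> \<in> R2_subbands d \<gamma>"
    using uc by (auto simp: union_closed_def)
  then obtain \<alpha> \<beta> where "fourier ` R2 0 1 d \<gamma> \<union> fourier ` R2 2 3 d \<gamma> = fourier ` R2 \<alpha> \<beta> d \<gamma>"
    unfolding R2_subbands_def by blast
  then have "fourier ` (R2 0 1 d \<gamma> \<union> R2 2 3 d \<gamma>) = fourier ` R2 \<alpha> \<beta> d \<gamma>"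
    by (simp only: image_Un)
  then have "R2 0 1 d \<gamma> \<union> R2 2 3 d \<gamma> = R2 \<alpha> \<beta> d \<gamma>"
    by (simp only: inj_image_eq_iff[OF inj_fourier])
  then have *: "t *\<^sub>R d \<in> R2 0 1 d \<gamma> \<or> t *\<^sub>R d \<in> R2 2 3 d \<gamma> \<longleftrightarrow> t *\<^sub>R d \<in> R2 \<alpha> \<beta> d \<gamma>" for t
    by blast
  show False
    using *[of 1] *[of 2] *[of "3/2"] by (simp add: ray del: scaleR_one)
qed

corollary not_pnf_controllable_R2_subbands:
  fixes d :: "real ^ 'n"
  assumes "norm d = 1"
  shows "\<not> pnf_controllable (R2_subbands d \<gamma>)"
  using not_union_closed_R2_subbands[OF assms] by (simp add: pnf_controllable_def)

end

theory Submission
  imports Defs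
begin

text \<open>Two vectors within angle \<open>\<gamma>\<close> of \<open>d\<close> enclose an angle of at most \<open>2\<gamma>\<close>, so that
  \<open>\<parallel>\<omega>1 + \<omega>2\<parallel>\<^sup>2 \<ge> \<parallel>\<omega>1\<parallel>\<^sup>2 + \<parallel>\<omega>2\<parallel>\<^sup>2 + 2 cos (2\<gamma>) \<parallel>\<omega>1\<parallel> \<parallel>\<omega>2\<parallel> \<ge> cos (2\<gamma>) (\<parallel>\<omega>1\<parallel> + \<parallel>\<omega>2\<parallel>)\<^sup>2\<close>.
  Instead of angles, the proof splits both vectors into components along \<open>d\<close> and orthogonal to \<open>d\<close>.
  Product control passes from a family to its finite unions by multiplying the members pairwise.\<close>

lemma ball2_choice:
  assumes "\<forall>x\<in>A. \<forall>y\<in>B. \<exists>z. P x y z"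
  shows "\<exists>f. \<forall>x\<in>A. \<forall>y\<in>B. P x y (f x y)"
  using assms by metis

text \<open>By choice, a tensor exists as soon as every pair of subbands has some suitable target.
  Later proofs can thus exhibit one target per pair instead of defining a global function that would
  have to recover radii from a set.\<close>

lemma product_controlled_iff:
  "product_controlled \<S> \<longleftrightarrow>
     (\<forall>S1\<in>\<S>. \<forall>S2\<in>\<S>. \<exists>T. T \<in> \<S> \<and> (\<forall>b1\<in>S1. \<forall>b2\<in>S2. (\<lambda>x. b1 x * b2 x) \<in> T))"
  (is "_ \<longleftrightarrow> (\<forall>S1\<in>\<S>. \<forall>S2\<in>\<S>. \<exists>T. ?P S1 S2 T)")
proof
  assume "product_controlled \<S>"
  then obtain t where t: "\<forall>S1\<in>\<S>. \<forall>S2\<in>\<S>. ?P S1 S2 (t S1 S2)"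
    unfolding product_controlled_def by (elim exE)
  show "\<forall>S1\<in>\<S>. \<forall>S2\<in>\<S>. \<exists>T. ?P S1 S2 T"
    by (intro ballI) (rule exI, rule t[rule_format])
next
  assume "\<forall>S1\<in>\<S>. \<forall>S2\<in>\<S>. \<exists>T. ?P S1 S2 T"
  then show "product_controlled \<S>"
    unfolding product_controlled_def by (rule ball2_choice)
qed

lemma union_closed_finite_unions: "union_closed (finite_unions \<S>)"
  unfolding union_closed_def
proof (intro ballI)
  fix S1 S2 assume "S1 \<in> finite_unions \<S>" "S2 \<in> finite_unions \<S>"
  then obtain F1 F2 where "S1 = \<Union>F1" "F1 \<subseteq> \<S>" "finite F1" "F1 \<noteq> {}"
    and "S2 = \<Union>F2" "F2 \<subseteq> \<S>" "finite F2" "F2 \<noteq> {}"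
    by (auto simp: finite_unions_def)
  then show "S1 \<union> S2 \<in> finite_unions \<S>"
    unfolding finite_unions_def by (intro CollectI exI[of _ "F1 \<union> F2"]) auto
qed

lemma product_controlled_finite_unions:
  assumes "product_controlled \<S>"
  shows "product_controlled (finite_unions \<S>)"
  unfolding product_controlled_iff
proof (intro ballI)
  obtain t where t: "\<forall>S1\<in>\<S>. \<forall>S2\<in>\<S>. t S1 S2 \<in> \<S> \<and>
      (\<forall>b1\<in>S1. \<forall>b2\<in>S2. (\<lambda>x. b1 x * b2 x) \<in> t S1 S2)"
    using assms unfolding product_controlled_def by (elim exE)
  fix S1 S2 assume "S1 \<in> finite_unions \<S>" "S2 \<in> finite_unions \<S>"
  then obtain F1 F2 where F1: "S1 = \<Union>F1" "F1 \<subseteq> \<S>" "finite F1" "F1 \<noteq> {}"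
    and F2: "S2 = \<Union>F2" "F2 \<subseteq> \<S>" "finite F2" "F2 \<noteq> {}"
    by (auto simp: finite_unions_def)
  have t': "t A B \<in> \<S>" "\<forall>b1\<in>A. \<forall>b2\<in>B. (\<lambda>x. b1 x * b2 x) \<in> t A B"
    if "A \<in> F1" "B \<in> F2" for A B
    using t[THEN bspec[of _ _ A], THEN bspec[of _ _ B]] that F1(2) F2(2) by (simp_all add: subsetD)
  \<comment> \<open>All pairwise tensors: finite because both families are, nonempty because both
    are, so their union is again an admissible finite union.\<close>
  define F where "F = case_prod t ` (F1 \<times> F2)"
  have "F \<subseteq> \<S>" "finite F" "F \<noteq> {}"
    using t'(1) F1(3,4) F2(3,4) by (auto simp: F_def)
  then have "\<Union>F \<in> finite_unions \<S>"
    unfolding finite_unions_def by (intro CollectI exI[of _ F] conjI refl)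
  moreover have "(\<lambda>x. b1 x * b2 x) \<in> \<Union>F" if b: "b1 \<in> S1" "b2 \<in> S2" for b1 b2
  proof -
    obtain A B where AB: "A \<in> F1" "b1 \<in> A" "B \<in> F2" "b2 \<in> B"
      using b unfolding F1(1) F2(1) by (elim UnionE)
    show ?thesis
    proof (rule UnionI)
      show "t A B \<in> F"
        unfolding F_def by (rule image_eqI[of _ _ "(A, B)"]) (simp_all add: AB)
      show "(\<lambda>x. b1 x * b2 x) \<in> t A B"
        by (rule t'(2)[OF AB(1,3), THEN bspec, OF AB(2), THEN bspec, OF AB(4)])
    qed
  qed
  ultimately show "\<exists>T. T \<in> finite_unions \<S> \<and> (\<forall>b1\<in>S1. \<forall>b2\<in>S2. (\<lambda>x. b1 x * b2 x) \<in> T)"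
    by (intro exI[of _ "\<Union>F"] conjI ballI)
qed

lemma finite_unions_subset:
  assumes "\<And>S. S \<in> \<S> \<Longrightarrow> S \<subseteq> B" and "S \<in> finite_unions \<S>"
  shows "S \<subseteq> B"
  using assms by (auto simp: finite_unions_def)

text \<open>Union closure comes for free from the construction, which leaves the basis inclusion and
  product control to be checked on the generating family.\<close>

lemma pnf_controllable_finite_unions:
  assumes "\<And>S. S \<in> \<S> \<Longrightarrow> S \<subseteq> fourier_basis" and "product_controlled \<S>"
  shows "pnf_controllable (finite_unions \<S>)"
  unfolding pnf_controllable_def
proof (intro conjI ballI)
  show "S \<subseteq> fourier_basis" if "S \<in> finite_unions \<S>" for S
    using assms(1) that by (rule finite_unions_subset)
qed (rule union_closed_finite_unions product_controlled_finite_unions assms(2))+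

lemma fourier_add: "fourier (a + b) = (\<lambda>x. fourier a x * fourier b x)"
  by (simp add: fourier_def fun_eq_iff inner_add_left algebra_simps flip: exp_add)

text \<open>The product is already the basis function of the sum of the frequencies, and
  \<open>inj_fourier\<close> makes that frequency unique.\<close>

lemma fourier_mult_eqD:
  assumes "(\<lambda>x. fourier a x * fourier b x) = fourier c"
  shows "c = a + b"
proof (rule injD[OF inj_fourier])
  show "fourier c = fourier (a + b)"
    unfolding fourier_add by (rule assms[symmetric])
qed

text \<open>The components along \<open>d\<close> contribute at least
  \<open>(cos \<gamma>)\<^sup>2 * (norm v * norm w)\<close>. By Cauchy-Schwarz the orthogonal ones
  contribute at least \<open>- (sin \<gamma>)\<^sup>2 * (norm v * norm w)\<close>. The double-angle
  formula adds these up.\<close>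

lemma inner_ge_cos_double:
  fixes d v w :: "'a::real_inner"
  assumes d: "norm d = 1" and c: "0 \<le> cos \<gamma>"
    and v: "cos \<gamma> * norm v \<le> v \<bullet> d" and w: "cos \<gamma> * norm w \<le> w \<bullet> d"
  shows "cos (2 * \<gamma>) * (norm v * norm w) \<le> v \<bullet> w"
proof -
  have dd: "d \<bullet> d = 1"
    using d by (simp add: norm_eq_1)
  define orth where "orth u = u - (u \<bullet> d) *\<^sub>R d" for u
  have orth: "norm (orth u) \<le> \<bar>sin \<gamma>\<bar> * norm u" if u: "cos \<gamma> * norm u \<le> u \<bullet> d" for u
  proof (rule power2_le_imp_le)
    \<comment> \<open>Squaring keeps the inequality since \<open>cos \<gamma>\<close> is
      nonnegative; Pythagoras then turns a large component along \<open>d\<close> into a small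
      orthogonal one.\<close>
    have "(cos \<gamma> * norm u)\<^sup>2 \<le> (u \<bullet> d)\<^sup>2"
      using u c by (intro power_mono) auto
    moreover have "(norm (orth u))\<^sup>2 = (norm u)\<^sup>2 - (u \<bullet> d)\<^sup>2"
      unfolding orth_def power2_norm_eq_inner
      by (simp add: inner_diff_left inner_diff_right dd inner_commute power2_eq_square)
    ultimately show "(norm (orth u))\<^sup>2 \<le> (\<bar>sin \<gamma>\<bar> * norm u)\<^sup>2"
      by (simp add: power_mult_distrib sin_squared_eq algebra_simps)
  qed simp
  have "norm (orth v) * norm (orth w) \<le> (\<bar>sin \<gamma>\<bar> * norm v) * (\<bar>sin \<gamma>\<bar> * norm w)"
    using orth[OF v] orth[OF w] by (intro mult_mono) auto
  then have "- ((sin \<gamma>)\<^sup>2 * (norm v * norm w)) \<le> orth v \<bullet> orth w"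
    using Cauchy_Schwarz_ineq2[of "orth v" "orth w"]
    by (simp add: power2_eq_square mult_ac flip: abs_mult)
  moreover have "(cos \<gamma> * norm v) * (cos \<gamma> * norm w) \<le> (v \<bullet> d) * (w \<bullet> d)"
    using v w c by (intro mult_mono) (auto intro: order_trans[rotated])
  moreover have "v \<bullet> w = (v \<bullet> d) * (w \<bullet> d) + orth v \<bullet> orth w"
    by (simp add: orth_def inner_diff_left inner_diff_right dd inner_commute)
  ultimately show ?thesis
    by (simp only: cos_double) (simp add: algebra_simps power2_eq_square)
qed

text \<open>Expand the square of the norm of the sum: the mixed term is bounded by hypothesis, and
  \<open>c \<le> 1\<close> lets the two pure squares absorb the factor \<open>c\<close>.\<close>

lemma norm_add_ge_sqrt:
  fixes v w :: "'a::real_inner"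
  assumes "c \<le> 1" and vw: "c * (norm v * norm w) \<le> v \<bullet> w"
  shows "sqrt c * (norm v + norm w) \<le> norm (v + w)"
proof -
  have "c * (norm v + norm w)\<^sup>2 \<le> (norm (v + w))\<^sup>2"
  proof -
    have "c * ((norm v)\<^sup>2 + (norm w)\<^sup>2) \<le> (norm v)\<^sup>2 + (norm w)\<^sup>2"
      using assms(1) by (simp add: mult_left_le_one_le mult_right_mono[of c 1, simplified])
    moreover have "(norm (v + w))\<^sup>2 = (norm v)\<^sup>2 + (norm w)\<^sup>2 + 2 * (v \<bullet> w)"
      by (simp add: power2_norm_eq_inner inner_add_left inner_add_right inner_commute)
    ultimately show ?thesis
      using vw by (simp add: power2_sum algebra_simps)
  qed
  then have "sqrt (c * (norm v + norm w)\<^sup>2) \<le> norm (v + w)"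
    by (simp add: real_le_lsqrt)
  then show ?thesis
    by (simp add: real_sqrt_mult)
qed

lemma R2_add:
  fixes d :: "real ^ 'n"
  assumes d: "norm d = 1" and \<gamma>: "0 \<le> cos \<gamma>" "0 \<le> cos (2 * \<gamma>)"
    and v: "v \<in> R2 \<alpha>1 \<beta>1 d \<gamma>" and w: "w \<in> R2 \<alpha>2 \<beta>2 d \<gamma>"
  shows "v + w \<in> R2 (sqrt (cos (2 * \<gamma>)) * (\<alpha>1 + \<alpha>2)) (\<beta>1 + \<beta>2) d \<gamma>"
proof -
  have v': "\<alpha>1 \<le> norm v" "norm v \<le> \<beta>1" "cos \<gamma> * norm v \<le> v \<bullet> d"
    and w': "\<alpha>2 \<le> norm w" "norm w \<le> \<beta>2" "cos \<gamma> * norm w \<le> w \<bullet> d"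
    using v w by (auto simp: R2_def)
  have "sqrt (cos (2 * \<gamma>)) * (\<alpha>1 + \<alpha>2) \<le> sqrt (cos (2 * \<gamma>)) * (norm v + norm w)"
    using v' w' \<gamma>(2) by (intro mult_left_mono add_mono) auto
  also have "\<dots> \<le> norm (v + w)"
    using inner_ge_cos_double[OF d \<gamma>(1) v'(3) w'(3)] by (intro norm_add_ge_sqrt) auto
  finally have "sqrt (cos (2 * \<gamma>)) * (\<alpha>1 + \<alpha>2) \<le> norm (v + w)" .
  moreover have "norm (v + w) \<le> \<beta>1 + \<beta>2"
    using norm_triangle_ineq[of v w] v' w' by linarith
  \<comment> \<open>The cone is convex: the triangle inequality, scaled by the nonnegative
    \<open>cos \<gamma>\<close>, reduces the claim to the sum of the two cone conditions.\<close>
  moreover have "cos \<gamma> * norm (v + w) \<le> (v + w) \<bullet> d"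
    using mult_left_mono[OF norm_triangle_ineq[of v w] \<gamma>(1)] v' w'
    by (simp add: inner_add_left algebra_simps)
  ultimately show ?thesis
    by (simp add: R2_def)
qed

lemma R2_subbandsI: "0 \<le> \<alpha> \<Longrightarrow> \<alpha> \<le> \<beta> \<Longrightarrow> fourier ` R2 \<alpha> \<beta> d \<gamma> \<in> R2_subbands d \<gamma>"
  unfolding R2_subbands_def by blast

text \<open>The factor \<open>sqrt (cos (2 * \<gamma>))\<close> lies between 0 and 1, so the new
  inner radius is nonnegative and does not exceed the new outer radius.\<close>

lemma R2_subbands_tensor:
  assumes "0 \<le> cos (2 * \<gamma>)" "0 \<le> \<alpha>1" "\<alpha>1 \<le> \<beta>1" "0 \<le> \<alpha>2" "\<alpha>2 \<le> \<beta>2"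
  shows "fourier ` R2 (sqrt (cos (2 * \<gamma>)) * (\<alpha>1 + \<alpha>2)) (\<beta>1 + \<beta>2) d \<gamma> \<in> R2_subbands d \<gamma>"
proof (rule R2_subbandsI)
  have "sqrt (cos (2 * \<gamma>)) * (\<alpha>1 + \<alpha>2) \<le> \<alpha>1 + \<alpha>2"
    using assms by (intro mult_left_le_one_le) auto
  then show "sqrt (cos (2 * \<gamma>)) * (\<alpha>1 + \<alpha>2) \<le> \<beta>1 + \<beta>2"
    using assms by linarith
qed (use assms in simp)

lemma product_controlled_R2_subbands:
  fixes d :: "real ^ 'n"
  assumes "norm d = 1" "0 \<le> cos \<gamma>" "0 \<le> cos (2 * \<gamma>)"
  shows "product_controlled (R2_subbands d \<gamma>)"
  unfolding product_controlled_iff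
proof (intro ballI)
  fix S1 S2 assume "S1 \<in> R2_subbands d \<gamma>" "S2 \<in> R2_subbands d \<gamma>"
  then obtain \<alpha>1 \<beta>1 \<alpha>2 \<beta>2 where S: "S1 = fourier ` R2 \<alpha>1 \<beta>1 d \<gamma>" "S2 = fourier ` R2 \<alpha>2 \<beta>2 d \<gamma>"
    and ab: "0 \<le> \<alpha>1" "\<alpha>1 \<le> \<beta>1" "0 \<le> \<alpha>2" "\<alpha>2 \<le> \<beta>2"
    unfolding R2_subbands_def by blast
  have "(\<lambda>x. b1 x * b2 x) \<in> fourier ` R2 (sqrt (cos (2 * \<gamma>)) * (\<alpha>1 + \<alpha>2)) (\<beta>1 + \<beta>2) d \<gamma>"
    if "b1 \<in> S1" "b2 \<in> S2" for b1 b2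
    using that R2_add[OF assms] by (auto simp: S simp flip: fourier_add)
  then show "\<exists>T. T \<in> R2_subbands d \<gamma> \<and> (\<forall>b1\<in>S1. \<forall>b2\<in>S2. (\<lambda>x. b1 x * b2 x) \<in> T)"
    using R2_subbands_tensor[OF assms(3) ab] by blast
qed

lemma R2_subbands_directed:
  assumes "S1 \<in> R2_subbands d \<gamma>" "S2 \<in> R2_subbands d \<gamma>"
  shows "\<exists>S\<in>R2_subbands d \<gamma>. S1 \<union> S2 \<subseteq> S"
proof -
  obtain \<alpha>1 \<beta>1 \<alpha>2 \<beta>2 where S: "S1 = fourier ` R2 \<alpha>1 \<beta>1 d \<gamma>" "S2 = fourier ` R2 \<alpha>2 \<beta>2 d \<gamma>"
    and ab: "0 \<le> \<alpha>1" "\<alpha>1 \<le> \<beta>1" "0 \<le> \<alpha>2" "\<alpha>2 \<le> \<beta>2"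
    using assms unfolding R2_subbands_def by blast
  \<comment> \<open>Dropping the inner radius to 0 fills any gap between the two annuli; the cone
    condition is common to all three sets.\<close>
  have "R2 \<alpha>1 \<beta>1 d \<gamma> \<union> R2 \<alpha>2 \<beta>2 d \<gamma> \<subseteq> R2 0 (max \<beta>1 \<beta>2) d \<gamma>"
    by (auto simp: R2_def)
  then have "S1 \<union> S2 \<subseteq> fourier ` R2 0 (max \<beta>1 \<beta>2) d \<gamma>"
    unfolding S by blast
  moreover have "fourier ` R2 0 (max \<beta>1 \<beta>2) d \<gamma> \<in> R2_subbands d \<gamma>"
    using ab by (intro R2_subbandsI) auto
  ultimately show ?thesis
    by blast
qed

text \<open>Controllability is claimed for \<open>finite_unions\<close> because the bare family
  fails union closure (\<open>not_union_closed_R2_subbands\<close>). The first two conjuncts record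
  what the bare family does satisfy: product control, and directedness under inclusion in place of
  union closure.\<close>

theorem theorem3:
  fixes d :: "real ^ 'n" and \<gamma> :: real
  assumes "norm d = 1" and "\<bar>\<gamma>\<bar> < pi / 4"
  shows "product_controlled (R2_subbands d \<gamma>)
    \<and> (\<forall>S1\<in>R2_subbands d \<gamma>. \<forall>S2\<in>R2_subbands d \<gamma>. \<exists>S\<in>R2_subbands d \<gamma>. S1 \<union> S2 \<subseteq> S)
    \<and> pnf_controllable (finite_unions (R2_subbands d \<gamma>))
    \<and> (\<forall>\<alpha>1 \<beta>1 \<alpha>2 \<beta>2 \<omega>1 \<omega>2 \<omega>3.
         0 \<le> \<alpha>1 \<and> \<alpha>1 \<le> \<beta>1 \<and> 0 \<le> \<alpha>2 \<and> \<alpha>2 \<le> \<beta>2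
         \<and> \<omega>1 \<in> R2 \<alpha>1 \<beta>1 d \<gamma> \<and> \<omega>2 \<in> R2 \<alpha>2 \<beta>2 d \<gamma>
         \<and> (\<lambda>x. fourier \<omega>1 x * fourier \<omega>2 x) = fourier \<omega>3
         \<longrightarrow> \<omega>3 \<in> R2 (sqrt (cos (2 * \<gamma>)) * (\<alpha>1 + \<alpha>2)) (\<beta>1 + \<beta>2) d \<gamma>
           \<and> fourier ` R2 (sqrt (cos (2 * \<gamma>)) * (\<alpha>1 + \<alpha>2)) (\<beta>1 + \<beta>2) d \<gamma> \<in> R2_subbands d \<gamma>)"
proof -
  \<comment> \<open>The angle bound enters here: it places both \<open>\<gamma>\<close> and
    \<open>2 * \<gamma>\<close> between \<open>- pi / 2\<close> and \<open>pi / 2\<close>, where the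
    cosine is nonnegative.\<close>
  have \<gamma>: "0 \<le> cos \<gamma>" "0 \<le> cos (2 * \<gamma>)"
    using assms(2) by (auto intro!: cos_ge_zero)
  note pc = product_controlled_R2_subbands[OF assms(1) \<gamma>]
  show ?thesis
  proof (intro conjI allI impI)
    show "product_controlled (R2_subbands d \<gamma>)"
      by (rule pc)
    show "\<forall>S1\<in>R2_subbands d \<gamma>. \<forall>S2\<in>R2_subbands d \<gamma>. \<exists>S\<in>R2_subbands d \<gamma>. S1 \<union> S2 \<subseteq> S"
      by (intro ballI R2_subbands_directed)
    show "pnf_controllable (finite_unions (R2_subbands d \<gamma>))"
    proof (rule pnf_controllable_finite_unions)
      show "S \<subseteq> fourier_basis" if "S \<in> R2_subbands d \<gamma>" for S
        using that unfolding R2_subbands_def fourier_basis_def by blast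
    qed (rule pc)
  next
    fix \<alpha>1 \<beta>1 \<alpha>2 \<beta>2 \<omega>1 \<omega>2 \<omega>3
    assume *: "0 \<le> \<alpha>1 \<and> \<alpha>1 \<le> \<beta>1 \<and> 0 \<le> \<alpha>2 \<and> \<alpha>2 \<le> \<beta>2
      \<and> \<omega>1 \<in> R2 \<alpha>1 \<beta>1 d \<gamma> \<and> \<omega>2 \<in> R2 \<alpha>2 \<beta>2 d \<gamma>
      \<and> (\<lambda>x. fourier \<omega>1 x * fourier \<omega>2 x) = fourier \<omega>3"
    then have "\<omega>3 = \<omega>1 + \<omega>2"
      by (elim conjE) (rule fourier_mult_eqD)
    then show "\<omega>3 \<in> R2 (sqrt (cos (2 * \<gamma>)) * (\<alpha>1 + \<alpha>2)) (\<beta>1 + \<beta>2) d \<gamma>"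
      using R2_add[OF assms(1) \<gamma>] * by simp
    show "fourier ` R2 (sqrt (cos (2 * \<gamma>)) * (\<alpha>1 + \<alpha>2)) (\<beta>1 + \<beta>2) d \<gamma> \<in> R2_subbands d \<gamma>"
      using * by (intro R2_subbands_tensor \<gamma>(2)) simp_all
  qed
qed

end
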